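(* Let $k\ge1$ be an integer. For every real $c<k$, no randomized online algorithm for the $k$-Canadian Traveller Problem with predictions is $c$-competitive against an oblivious adversary, even when restricted to instances whose prediction error is at most $1$ and whose graph is path-disjoint; that is, for every randomized algorithm there is such an instance with $\mathbb{E}[ALG]>c\cdot OPT$.
   Context: $k$-Canadian Traveller Problem ($k$-CTP) with predictions: an instance consists of a connected undirected graph $G=(V,E)$, a source $s$, a destination $t$, a nonnegative cost function $c:E\to\mathbb{R}^+$, an unknown set $B\subseteq E$ of blocked edges with $|B|\le k$ such that $G-B$ contains an $s$-$t$ path, and a predicted set $B_p\subseteq E$ of blocked edges with $|B_p|\le k$. The traveller knows $G,c,s,t,k,B_p$ in advance, starts at $s$, and learns whether an edge is blocked only upon reaching one of its endpoints; blocked edges cannot be traversed. $ALG$ is the (random) total cost travelled, $OPT$ the cost of a shortest $s$-$t$ path in $G-B$. A randomized algorithm is $c$-competitive against an oblivious adversary if $\mathbb{E}[ALG]\le c\cdot OPT$ on every instance (instances fixed independently of the algorithm's random choices). The prediction error is $|B\triangle B_p|$. A graph is path-disjoint if all its $s$-$t$ paths are pairwise node-disjoint apart from $s$ and $t$. *)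

theory Defs
  imports "HOL-Probability.Probability"
begin

text \<open>An undirected edge is a two-element set of vertices.  Vertices are natural numbers, so that
  a single algorithm can be run on all finite graphs.\<close>

type_synonym edge = "nat set"

text \<open>What the traveller knows in advance.  The bound \<open>k\<close> is a parameter of the problem, and the
  actual set of blocked edges is kept separate because it is hidden.\<close>

record ctp_input =
  verts :: "nat set"
  edges :: "edge set"
  cost :: "edge \<Rightarrow> real"
  src :: nat
  dst :: nat
  pred_blocked :: "edge set"

definition is_path :: "edge set \<Rightarrow> nat \<Rightarrow> nat \<Rightarrow> nat list \<Rightarrow> bool" where
  "is_path E u v p \<longleftrightarrow>
     p \<noteq> [] \<and> hd p = u \<and> last p = v \<and> distinct p \<and> successively (\<lambda>x y. {x, y} \<in> E) p"

definition walk_cost :: "ctp_input \<Rightarrow> nat list \<Rightarrow> real" where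
  "walk_cost I w = (\<Sum>(x, y) \<leftarrow> zip w (tl w). cost I {x, y})"

definition ctp_instance :: "nat \<Rightarrow> ctp_input \<Rightarrow> edge set \<Rightarrow> bool" where
  "ctp_instance k I B \<longleftrightarrow>
     finite (verts I) \<and>
     (\<forall>e \<in> edges I. e \<subseteq> verts I \<and> card e = 2) \<and>
     (\<forall>u \<in> verts I. \<forall>v \<in> verts I. \<exists>p. is_path (edges I) u v p) \<and>
     (\<forall>e \<in> edges I. cost I e \<ge> 0) \<and>
     src I \<in> verts I \<and> dst I \<in> verts I \<and>
     B \<subseteq> edges I \<and> card B \<le> k \<and>
     (\<exists>p. is_path (edges I - B) (src I) (dst I) p) \<and>
     pred_blocked I \<subseteq> edges I \<and> card (pred_blocked I) \<le> k"

definition prediction_error :: "ctp_input \<Rightarrow> edge set \<Rightarrow> nat" where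
  "prediction_error I B = card (sym_diff B (pred_blocked I))"

definition path_disjoint :: "ctp_input \<Rightarrow> bool" where
  "path_disjoint I \<longleftrightarrow>
     (\<forall>p q. is_path (edges I) (src I) (dst I) p \<and> is_path (edges I) (src I) (dst I) q \<and> p \<noteq> q
        \<longrightarrow> set p \<inter> set q \<subseteq> {src I, dst I})"

definition opt_cost :: "ctp_input \<Rightarrow> edge set \<Rightarrow> real" where
  "opt_cost I B = Min (walk_cost I ` {p. is_path (edges I - B) (src I) (dst I) p})"

text \<open>A deterministic online algorithm chooses the next vertex from the input, the walk made so
  far, and the blocked edges revealed by it.  An edge incident to a visited vertex and not among
  the revealed ones is thereby known to be free.\<close>

type_synonym strategy = "ctp_input \<Rightarrow> nat list \<Rightarrow> edge set \<Rightarrow> nat"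

definition revealed :: "edge set \<Rightarrow> nat list \<Rightarrow> edge set" where
  "revealed B w = {e \<in> B. e \<inter> set w \<noteq> {}}"

text \<open>The walk after \<open>n\<close> moves.  It ends at the destination.  If the strategy proposes an illegal
  move, the traveller stays put, sees the same information again, and hence is stuck forever.\<close>

primrec walk :: "strategy \<Rightarrow> ctp_input \<Rightarrow> edge set \<Rightarrow> nat \<Rightarrow> nat list" where
  "walk S I B 0 = [src I]"
| "walk S I B (Suc n) =
     (let w = walk S I B n; u = last w; v = S I w (revealed B w)
      in if u \<noteq> dst I \<and> {u, v} \<in> edges I - B then w @ [v] else w)"

text \<open>A run that never reaches the destination has infinite cost; otherwise doing nothing would be
  free.\<close>

definition alg_cost :: "strategy \<Rightarrow> ctp_input \<Rightarrow> edge set \<Rightarrow> ennreal" where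
  "alg_cost S I B =
     (if \<exists>n. last (walk S I B n) = dst I
      then ennreal (walk_cost I (walk S I B (LEAST n. last (walk S I B n) = dst I)))
      else \<infinity>)"

text \<open>A randomized algorithm is a random deterministic algorithm, drawn from an arbitrary
  probability space.  Measurability of every single decision makes \<open>alg_cost\<close> a random variable
  on every instance.\<close>

definition randomized_algorithm :: "'w measure \<Rightarrow> ('w \<Rightarrow> strategy) \<Rightarrow> bool" where
  "randomized_algorithm M A \<longleftrightarrow>
     prob_space M \<and> (\<forall>I w R. (\<lambda>\<omega>. A \<omega> I w R) \<in> measurable M (count_space UNIV))"

text \<open>The value is an extended real so that it can be compared with a possibly negative multiple
  of the optimum.\<close>

definition expected_cost :: "'w measure \<Rightarrow> ('w \<Rightarrow> strategy) \<Rightarrow> ctp_input \<Rightarrow> edge set \<Rightarrow> ereal" where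
  "expected_cost M A I B = enn2ereal (\<integral>\<^sup>+ \<omega>. alg_cost (A \<omega>) I B \<partial>M)"

end

theory Submission
  imports Defs
begin

text \<open>The graph consists of \<open>k\<close> paths of cost \<open>1\<close> through the middle vertices \<open>v\<^sub>0, \<dots>, v\<^sub>k\<^sub>-\<^sub>1\<close>, and
  the last edge of every path is predicted to be blocked.  All predictions but that for a uniformly
  random path are correct.  Until the traveller visits the right middle vertex the run coincides
  with the one where all last edges are blocked, and there at most \<open>(n + 1) div 2\<close> middle vertices
  are visited within \<open>n\<close> moves.  The number of moves before \<open>v\<^sub>i\<close> is visited, summed over all \<open>i\<close>,
  is thus at least \<open>1 + 3 + \<dots> + (2k - 1) = k\<^sup>2\<close>, so the cost is at least \<open>k\<close> on average over
  \<open>i\<close>, whereas the optimum is \<open>1\<close>.\<close>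

section \<open>The graph of parallel paths and its instances\<close>

definition last_edge :: "nat \<Rightarrow> edge" where
  "last_edge i = {Suc (Suc i), 1}"

definition last_edges :: "nat \<Rightarrow> edge set" where
  "last_edges k = last_edge ` {..<k}"

text \<open>All cost sits on the edges at the source. Every source-destination path then costs 1,
  and so does every single move along an edge other than a last edge, which turns cost into a count
  of moves.\<close>

definition parallel_paths :: "nat \<Rightarrow> ctp_input" where
  "parallel_paths k =
     \<lparr>verts = {..<k + 2},
      edges = (\<lambda>i. {0, Suc (Suc i)}) ` {..<k} \<union> last_edges k,
      cost = (\<lambda>e. if 0 \<in> e then 1 else 0),
      src = 0, dst = 1, pred_blocked = last_edges k\<rparr>"

lemma parallel_paths_simps [simp]:
  "verts (parallel_paths k) = {..<k + 2}"
  "cost (parallel_paths k) = (\<lambda>e. if 0 \<in> e then 1 else 0)"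
  "src (parallel_paths k) = 0"
  "dst (parallel_paths k) = 1"
  "pred_blocked (parallel_paths k) = last_edges k"
  by (simp_all add: parallel_paths_def)

lemma edges_parallel_paths:
  "edges (parallel_paths k) = (\<lambda>i. {0, Suc (Suc i)}) ` {..<k} \<union> last_edges k"
  by (simp add: parallel_paths_def)

lemma inj_last_edge: "inj last_edge"
  by (auto simp: inj_on_def last_edge_def doubleton_eq_iff)

lemma last_edge_eq_iff [simp]: "last_edge i = last_edge j \<longleftrightarrow> i = j"
  using inj_last_edge by (auto dest: injD)

lemma finite_last_edges [simp]: "finite (last_edges k)"
  by (simp add: last_edges_def)

lemma card_last_edges [simp]: "card (last_edges k) = k"
  by (simp add: last_edges_def card_image inj_on_subset[OF inj_last_edge])

lemma last_edge_in_last_edges [simp]: "last_edge i \<in> last_edges k \<longleftrightarrow> i < k"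
  by (auto simp: last_edges_def)

lemma first_edge_notin_last_edges: "{0, v} \<notin> last_edges k"
  by (simp add: last_edges_def last_edge_def image_iff doubleton_eq_iff)

lemma edge_from_source_iff:
  "{0, v} \<in> edges (parallel_paths k) \<longleftrightarrow> (\<exists>i<k. v = Suc (Suc i))"
  by (auto simp: edges_parallel_paths first_edge_notin_last_edges doubleton_eq_iff)

lemma edge_from_middle_iff:
  "{Suc (Suc i), v} \<in> edges (parallel_paths k) \<longleftrightarrow> i < k \<and> (v = 0 \<or> v = 1)"
  unfolding edges_parallel_paths last_edges_def last_edge_def
  by (simp add: image_iff doubleton_eq_iff Bex_def) blast

text \<open>From the source a path can only enter a middle vertex, whose only other neighbour is the
  destination; there \<open>last p = 1\<close> and \<open>distinct p\<close> end the path.\<close>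

lemma parallel_paths_is_pathD:
  assumes "is_path (edges (parallel_paths k)) 0 1 p"
  obtains i where "i < k" "p = [0, Suc (Suc i), 1]"
proof -
  from assms have p: "p \<noteq> []" "hd p = 0" "last p = 1" "distinct p"
      "successively (\<lambda>x y. {x, y} \<in> edges (parallel_paths k)) p"
    unfolding is_path_def by blast+
  obtain q where q: "p = 0 # q" using p by (cases p) auto
  obtain v r where r: "q = v # r" using p q by (cases q) auto
  obtain i where i: "i < k" "v = Suc (Suc i)" using p q r by (auto simp: edge_from_source_iff)
  obtain x l where l: "r = x # l" using p q r i by (cases r) auto
  have x: "x = 1" using p q r i l by (auto simp: edge_from_middle_iff)
  have "l = []" using p q r l x by (cases l rule: rev_cases) auto
  with q r i l x that show thesis by auto
qed

lemma parallel_paths_is_path: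
  assumes "i < k"
  shows "is_path (edges (parallel_paths k) - (last_edges k - {last_edge i})) 0 1
           [0, Suc (Suc i), 1]"
  using assms first_edge_notin_last_edges
  by (auto simp: is_path_def edge_from_source_iff edge_from_middle_iff last_edge_def)

lemma path_disjoint_parallel_paths: "path_disjoint (parallel_paths k)"
  unfolding path_disjoint_def parallel_paths_simps
proof (intro allI impI, elim conjE)
  fix p q
  assume "is_path (edges (parallel_paths k)) 0 1 p" "is_path (edges (parallel_paths k)) 0 1 q"
    and "p \<noteq> q"
  then obtain i j where "p = [0, Suc (Suc i), 1]" "q = [0, Suc (Suc j), 1]"
    by (metis parallel_paths_is_pathD)
  with \<open>p \<noteq> q\<close> show "set p \<inter> set q \<subseteq> {0, 1}" by auto
qed

lemma opt_cost_parallel_paths: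
  assumes "i < k"
  shows "opt_cost (parallel_paths k) (last_edges k - {last_edge i}) = 1"
proof -
  have "{p. is_path (edges (parallel_paths k) - (last_edges k - {last_edge i})) 0 1 p} =
          {[0, Suc (Suc i), 1]}" (is "?L = ?R")
  proof
    show "?L \<subseteq> ?R"
    proof
      fix p assume "p \<in> ?L"
      then have p: "is_path (edges (parallel_paths k) - (last_edges k - {last_edge i})) 0 1 p"
        by simp
      then have "is_path (edges (parallel_paths k)) 0 1 p"
        by (auto simp: is_path_def elim: successively_mono)
      then obtain j where j: "j < k" "p = [0, Suc (Suc j), 1]"
        by (rule parallel_paths_is_pathD)
      with p have "last_edge j \<notin> last_edges k - {last_edge i}"
        by (auto simp: is_path_def last_edge_def)
      with j show "p \<in> ?R" by simp
    qed
  qed (use parallel_paths_is_path[OF assms] in simp)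
  then show ?thesis by (simp add: opt_cost_def walk_cost_def)
qed

text \<open>Distinct vertices that are not adjacent have a common neighbour: the source for two
  middle vertices, and for source and destination the middle vertex \<open>Suc (Suc 0)\<close>,
  which exists by \<open>k \<ge> 1\<close>.\<close>

lemma connected_parallel_paths:
  assumes "k \<ge> 1" "u < k + 2" "v < k + 2"
  shows "\<exists>p. is_path (edges (parallel_paths k)) u v p"
proof -
  have middle: "x = 0 \<or> x = 1 \<or> (\<exists>i<k. x = Suc (Suc i))" if "x < k + 2" for x :: nat
    using that by (cases x; cases "x - 1") auto
  have "is_path (edges (parallel_paths k)) u v [u]" if "u = v"
    using that by (simp add: is_path_def)
  moreover have "is_path (edges (parallel_paths k)) u v [u, v]"
    if "u \<noteq> v" "{u, v} \<in> edges (parallel_paths k)"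
    using that by (simp add: is_path_def)
  moreover have "is_path (edges (parallel_paths k)) u v [u, x, v]"
    if "distinct [u, x, v]" "{x, u} \<in> edges (parallel_paths k)"
      "{x, v} \<in> edges (parallel_paths k)" for x
    using that by (auto simp: is_path_def insert_commute)
  moreover have "u = v \<or> u \<noteq> v \<and> {u, v} \<in> edges (parallel_paths k) \<or>
      (\<exists>x. distinct [u, x, v] \<and> {x, u} \<in> edges (parallel_paths k) \<and>
        {x, v} \<in> edges (parallel_paths k))"
  proof -
    have edge: "{0, Suc (Suc i)} \<in> edges (parallel_paths k)"
      "{Suc (Suc i), 0} \<in> edges (parallel_paths k)"
      "{Suc (Suc i), 1} \<in> edges (parallel_paths k)"
      "{1, Suc (Suc i)} \<in> edges (parallel_paths k)" if "i < k" for i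
      using that edge_from_source_iff edge_from_middle_iff insert_commute by metis+
    have "0 < k" using assms by simp
    consider "u = v" | "u = 0" "v = 1" | "u = 1" "v = 0"
      | i where "i < k" "u = Suc (Suc i)" "v = 0 \<or> v = 1"
      | i where "i < k" "v = Suc (Suc i)" "u = 0 \<or> u = 1"
      | i j where "i < k" "u = Suc (Suc i)" "j < k" "v = Suc (Suc j)" "i \<noteq> j"
      using middle[OF assms(2)] middle[OF assms(3)] by auto
    then show ?thesis
    proof cases
      case 2
      with edge[OF \<open>0 < k\<close>] show ?thesis by (intro disjI2 exI[of _ "Suc (Suc 0)"]) simp
    next
      case 3
      with edge[OF \<open>0 < k\<close>] show ?thesis by (intro disjI2 exI[of _ "Suc (Suc 0)"]) simp
    next
      case (4 i)
      with edge[of i] show ?thesis by auto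
    next
      case (5 i)
      with edge[of i] show ?thesis by auto
    next
      case (6 i j)
      with edge[of i] edge[of j] show ?thesis by (intro disjI2 exI[of _ 0]) simp
    qed simp
  qed
  ultimately show ?thesis by blast
qed

lemma ctp_instance_parallel_paths:
  assumes "i < k"
  shows "ctp_instance k (parallel_paths k) (last_edges k - {last_edge i})"
proof -
  have "card (last_edges k - {last_edge i}) \<le> card (last_edges k)"
    by (intro card_mono) auto
  moreover have "\<forall>e \<in> edges (parallel_paths k). e \<subseteq> {..<k + 2} \<and> card e = 2"
    by (auto simp: edges_parallel_paths last_edges_def last_edge_def)
  moreover have "last_edges k \<subseteq> edges (parallel_paths k)"
    by (simp add: edges_parallel_paths)
  ultimately show ?thesis
    using assms connected_parallel_paths[of k] parallel_paths_is_path[OF assms]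
    unfolding ctp_instance_def by (auto simp del: One_nat_def)
qed

lemma prediction_error_parallel_paths:
  assumes "i < k"
  shows "prediction_error (parallel_paths k) (last_edges k - {last_edge i}) = 1"
proof -
  have "sym_diff (last_edges k - {last_edge i}) (last_edges k) = {last_edge i}"
    using assms by auto
  then show ?thesis by (simp add: prediction_error_def)
qed

section \<open>General facts on walks\<close>

lemma walk_nonempty [simp]: "walk S I B n \<noteq> []"
  by (induction n) (auto simp: Let_def)

lemma set_walk_mono: "m \<le> n \<Longrightarrow> set (walk S I B m) \<subseteq> set (walk S I B n)"
  by (induction n rule: dec_induct) (auto simp: Let_def)

text \<open>An unchanged walk reveals the same information, so the deterministic strategy repeats
  its proposal and again nothing changes.\<close>

lemma walk_stuck:
  assumes "walk S I B (Suc n) = walk S I B n" "n \<le> m"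
  shows "walk S I B m = walk S I B n"
  using assms(2)
proof (induction m rule: dec_induct)
  case (step m)
  then show ?case using assms(1) by (auto simp: Let_def split: if_splits)
qed simp

lemma walk_cost_append:
  assumes "w \<noteq> []"
  shows "walk_cost I (w @ [v]) = walk_cost I w + cost I {last w, v}"
  using assms
proof (induction w)
  case (Cons x w)
  then show ?case by (cases w) (auto simp: walk_cost_def)
qed simp

section \<open>The run with all last edges blocked\<close>

text \<open>This run is a common reference for all \<open>i\<close> and not itself an instance,
  since the destination is cut off. Its free edges join only the source and the middle
  vertices.\<close>

lemma last_walk_all_blocked:
  "last (walk S (parallel_paths k) (last_edges k) n) = 0 \<or>
   (\<exists>i<k. last (walk S (parallel_paths k) (last_edges k) n) = Suc (Suc i))"
proof (induction n)
  case (Suc n)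
  let ?w = "walk S (parallel_paths k) (last_edges k) n"
  let ?v = "S (parallel_paths k) ?w (revealed (last_edges k) ?w)"
  have "?v = 0 \<or> (\<exists>i<k. ?v = Suc (Suc i))"
    if "{last ?w, ?v} \<in> edges (parallel_paths k) - last_edges k"
    using Suc
  proof
    assume "last ?w = 0"
    with that show ?thesis by (auto simp: edge_from_source_iff)
  next
    assume "\<exists>i<k. last ?w = Suc (Suc i)"
    then obtain i where i: "i < k" "last ?w = Suc (Suc i)" by auto
    then have "?v \<noteq> 1" using that last_edge_in_last_edges[of i k] by (auto simp: last_edge_def)
    with that i show ?thesis by (auto simp: edge_from_middle_iff)
  qed
  with Suc show ?case by (auto simp: Let_def)
qed simp

lemma destination_notin_walk_all_blocked:
  "1 \<notin> set (walk S (parallel_paths k) (last_edges k) n)"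
proof (induction n)
  case (Suc n)
  then show ?case using last_walk_all_blocked[of S k "Suc n"] by (auto simp: Let_def split: if_splits)
qed simp

text \<open>A middle vertex is left through the source only, so every second move is lost.\<close>

lemma card_visited_all_blocked:
  "2 * card {i. i < k \<and> Suc (Suc i) \<in> set (walk S (parallel_paths k) (last_edges k) n)}
     \<le> (if last (walk S (parallel_paths k) (last_edges k) n) = 0 then n else Suc n)"
proof (induction n)
  case (Suc n)
  let ?w = "walk S (parallel_paths k) (last_edges k)"
  let ?V = "\<lambda>n. {i. i < k \<and> Suc (Suc i) \<in> set (?w n)}"
  let ?v = "S (parallel_paths k) (?w n) (revealed (last_edges k) (?w n))"
  have "?w (Suc n) = ?w n \<or>
      ?w (Suc n) = ?w n @ [?v] \<and> {last (?w n), ?v} \<in> edges (parallel_paths k)"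
    by (simp add: Let_def)
  then consider "?w (Suc n) = ?w n"
    | "?w (Suc n) = ?w n @ [?v]" "{last (?w n), ?v} \<in> edges (parallel_paths k)"
    by blast
  then show ?case
  proof cases
    case 1
    then show ?thesis using Suc by (auto split: if_splits)
  next
    case 2
    \<comment> \<open>Leaving the source adds at most one middle vertex while the bound rises from
      \<open>n\<close> to \<open>n + 2\<close>; returning to it adds none while the bound stays at
      \<open>n + 1\<close>.\<close>
    show ?thesis
    proof (cases "last (?w n) = 0")
      case True
      then obtain i where i: "i < k" "?v = Suc (Suc i)" using 2 by (auto simp: edge_from_source_iff)
      then have "?V (Suc n) = insert i (?V n)" unfolding 2(1) by auto
      then have "card (?V (Suc n)) \<le> Suc (card (?V n))"
        by (simp add: card_insert_if)
      moreover have "last (?w (Suc n)) \<noteq> 0" using 2(1) i by simp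
      ultimately show ?thesis using Suc True by simp
    next
      case False
      then obtain i where i: "i < k" "last (?w n) = Suc (Suc i)"
        using last_walk_all_blocked[of S k n] by auto
      with 2 have "?v = 0 \<or> ?v = 1" by (simp add: edge_from_middle_iff)
      moreover have "?v \<noteq> 1"
        using 2(1) destination_notin_walk_all_blocked[of S k "Suc n"] by auto
      ultimately have "?v = 0" by simp
      then have "?V (Suc n) = ?V n" "last (?w (Suc n)) = 0" unfolding 2(1) by auto
      then show ?thesis using Suc False by simp
    qed
  qed
qed simp

section \<open>Cost of a run compared with the reference run\<close>

text \<open>The two blocked sets differ only in \<open>last_edge i\<close>, whose state shows only
  at its endpoints. The reference run has visited neither of them, so the strategy receives the same
  information in both runs.\<close>

lemma walk_eq_all_blocked:
  assumes "Suc (Suc i) \<notin> set (walk S (parallel_paths k) (last_edges k) n)"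
  shows "walk S (parallel_paths k) (last_edges k - {last_edge i}) n =
         walk S (parallel_paths k) (last_edges k) n"
  using assms
proof (induction n)
  case (Suc n)
  let ?w = "walk S (parallel_paths k) (last_edges k) n"
  have i: "Suc (Suc i) \<notin> set ?w"
    using Suc.prems set_walk_mono[of n "Suc n" S "parallel_paths k" "last_edges k"] by auto
  have t: "1 \<notin> set ?w" by (rule destination_notin_walk_all_blocked)
  have eq: "walk S (parallel_paths k) (last_edges k - {last_edge i}) n = ?w"
    using Suc.IH i by blast
  have rev: "revealed (last_edges k - {last_edge i}) ?w = revealed (last_edges k) ?w"
    using i t by (auto simp: revealed_def last_edge_def)
  have "last ?w \<in> set ?w" by simp
  then have "last ?w \<noteq> Suc (Suc i)" "last ?w \<noteq> 1" using i t by metis+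
  then have "{last ?w, v} \<noteq> last_edge i" for v
    by (auto simp: last_edge_def doubleton_eq_iff)
  then show ?case by (simp add: eq rev Let_def)
qed simp

text \<open>The walk is the reference run, not the run on the \<open>i\<close>-th instance, so that
  summing over \<open>i\<close> counts the unvisited middle vertices of one single walk.\<close>

definition unvisited :: "nat \<Rightarrow> strategy \<Rightarrow> nat \<Rightarrow> nat \<Rightarrow> real" where
  "unvisited k S i n =
     of_bool (Suc (Suc i) \<notin> set (walk S (parallel_paths k) (last_edges k) n))"

text \<open>Until the \<open>i\<close>-th middle vertex is visited, the run follows the reference
  run along edges at the source, paying 1 per move. The first assumption, with \<open>N\<close>
  later the arrival time, ensures that every step before \<open>n\<close> is a real move.\<close>

lemma walk_cost_ge_unvisited:
  assumes "\<And>m. m < n \<Longrightarrow>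
      last (walk S (parallel_paths k) (last_edges k - {last_edge i}) m) \<noteq>
      last (walk S (parallel_paths k) (last_edges k - {last_edge i}) N)"
    and "n \<le> N"
  shows "(\<Sum>m<n. unvisited k S i m) \<le>
           walk_cost (parallel_paths k) (walk S (parallel_paths k) (last_edges k - {last_edge i}) n)"
  using assms
proof (induction n)
  case 0
  show ?case by (simp add: walk_cost_def)
next
  case (Suc n)
  let ?I = "parallel_paths k"
  let ?B = "last_edges k - {last_edge i}"
  let ?w = "walk S ?I ?B"
  let ?v = "S ?I (?w n) (revealed ?B (?w n))"
  \<comment> \<open>A walk stuck at time \<open>n\<close> would still be the same at time
    \<open>N\<close>, with the same last vertex.\<close>
  have "?w (Suc n) \<noteq> ?w n"
    using walk_stuck[of S ?I ?B n N] Suc.prems(1)[of n] Suc.prems(2) by auto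
  then have w: "?w (Suc n) = ?w n @ [?v]" and e: "{last (?w n), ?v} \<in> edges ?I - ?B"
    by (auto simp: Let_def split: if_splits)
  have "unvisited k S i n \<le> cost ?I {last (?w n), ?v}"
  proof (cases "Suc (Suc i) \<in> set (walk S ?I (last_edges k) n)")
    case True
    then show ?thesis by (simp add: unvisited_def)
  next
    case False
    then have eq: "?w n = walk S ?I (last_edges k) n" by (rule walk_eq_all_blocked)
    have "last (?w n) \<in> set (?w n)" by simp
    then have "last (?w n) \<noteq> Suc (Suc i)" "last (?w n) \<noteq> 1"
      using False destination_notin_walk_all_blocked[of S k n] unfolding eq by metis+
    \<comment> \<open>The only free last edge is not the one taken, so the move uses an edge at the
      source.\<close>
    then have "{last (?w n), ?v} \<noteq> last_edge i" by (auto simp: last_edge_def doubleton_eq_iff)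
    with e have "{last (?w n), ?v} \<in> edges ?I - last_edges k" by blast
    moreover have "0 \<in> e" if "e \<in> edges ?I - last_edges k" for e
      using that by (auto simp: edges_parallel_paths)
    ultimately have "0 \<in> {last (?w n), ?v}" by blast
    then show ?thesis by (simp add: unvisited_def)
  qed
  moreover have "(\<Sum>m<n. unvisited k S i m) \<le> walk_cost ?I (?w n)"
    using Suc.prems by (intro Suc.IH) auto
  ultimately show ?case unfolding w by (simp add: walk_cost_append)
qed

lemma alg_cost_ge_unvisited:
  "ennreal (\<Sum>n<K. unvisited k S i n) \<le>
     alg_cost S (parallel_paths k) (last_edges k - {last_edge i})"
proof -
  let ?I = "parallel_paths k"
  let ?w = "walk S ?I (last_edges k - {last_edge i})"
  show ?thesis
  proof (cases "\<exists>n. last (?w n) = 1")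
    case True
    define N where "N = (LEAST n. last (?w n) = 1)"
    have N: "last (?w N) = 1" unfolding N_def using True by (rule LeastI_ex)
    have "last (?w m) \<noteq> 1" if "m < N" for m
      using not_less_Least that unfolding N_def by blast
    then have le: "(\<Sum>m<N. unvisited k S i m) \<le> walk_cost ?I (?w N)"
      using N by (intro walk_cost_ge_unvisited[of N]) auto
    \<comment> \<open>Otherwise the run would equal the reference run, which never reaches the
      destination. Hence all terms from \<open>N\<close> on vanish, and the bound holds for every
      horizon \<open>K\<close>.\<close>
    have "Suc (Suc i) \<in> set (walk S ?I (last_edges k) N)"
    proof (rule ccontr)
      assume "\<not> ?thesis"
      then have "?w N = walk S ?I (last_edges k) N" by (rule walk_eq_all_blocked)
      then show False
        using N destination_notin_walk_all_blocked[of S k N] last_in_set[of "?w N"] by simp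
    qed
    then have "unvisited k S i m = 0" if "m \<ge> N" for m
      using set_walk_mono[OF that, of S ?I "last_edges k"] by (auto simp: unvisited_def)
    then have "(\<Sum>m<K. unvisited k S i m) = (\<Sum>m\<in>{..<K} \<inter> {..<N}. unvisited k S i m)"
      by (intro sum.mono_neutral_right) (auto simp: not_less[symmetric])
    also have "\<dots> \<le> (\<Sum>m<N. unvisited k S i m)"
      by (intro sum_mono2) (auto simp: unvisited_def)
    finally have "(\<Sum>m<K. unvisited k S i m) \<le> (\<Sum>m<N. unvisited k S i m)" .
    with le show ?thesis using True unfolding alg_cost_def by (simp add: N_def ennreal_leI)
  next
    case False
    then show ?thesis by (simp add: alg_cost_def)
  qed
qed

section \<open>Counting over all paths\<close>

text \<open>At least \<open>k - (n + 1) div 2\<close> middle vertices are unvisited after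
  \<open>n\<close> steps. This is no longer positive from \<open>n = 2 * k\<close> on, which
  suggests the horizon, and summing it gives \<open>2 * k * k - k * k\<close>.\<close>

lemma sum_unvisited_ge:
  "real (k * k) \<le> (\<Sum>i<k. \<Sum>n<2 * k. unvisited k S i n)"
proof -
  let ?V = "\<lambda>n. {i. i < k \<and> Suc (Suc i) \<in> set (walk S (parallel_paths k) (last_edges k) n)}"
  have "(\<Sum>i<k. unvisited k S i n) \<ge> real k - real ((n + 1) div 2)" for n
  proof -
    have "(\<Sum>i<k. unvisited k S i n) + real (card (?V n)) =
        (\<Sum>i<k. unvisited k S i n + of_bool (i \<in> ?V n))"
      by (simp add: sum.distrib Int_def)
    also have "\<dots> = (\<Sum>i<k. 1)"
      by (intro sum.cong) (auto simp: unvisited_def)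
    finally have "(\<Sum>i<k. unvisited k S i n) = real k - real (card (?V n))" by simp
    moreover have "card (?V n) \<le> (n + 1) div 2"
      using card_visited_all_blocked[of k S n] by (simp split: if_splits)
    ultimately show ?thesis by simp
  qed
  then have "(\<Sum>n<2 * k. real k - real ((n + 1) div 2)) \<le>
      (\<Sum>n<2 * k. \<Sum>i<k. unvisited k S i n)"
    by (intro sum_mono)
  \<comment> \<open>The induction step adds the two terms \<open>j\<close> and
    \<open>j + 1\<close>.\<close>
  moreover have "(\<Sum>n<2 * j. (n + 1) div 2) = j * j" for j :: nat
    by (induction j) auto
  then have "(\<Sum>n<2 * k. real ((n + 1) div 2)) = real (k * k)"
    by (metis of_nat_sum)
  ultimately show ?thesis
    by (subst sum.swap) (simp add: sum_subtractf)
qed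

section \<open>Measurability and averaging over the paths\<close>

text \<open>For a fixed walk \<open>w\<close> the next decision is measurable by assumption. Walks
  form a countable type, so the random walk may be substituted for \<open>w\<close>.\<close>

lemma measurable_walk:
  assumes "randomized_algorithm M A"
  shows "(\<lambda>\<omega>. walk (A \<omega>) I B n) \<in> measurable M (count_space UNIV)"
proof (induction n)
  case (Suc n)
  have A: "(\<lambda>\<omega>. A \<omega> I w R) \<in> measurable M (count_space UNIV)" for w R
    using assms by (auto simp: randomized_algorithm_def)
  have "(\<lambda>\<omega>. (\<lambda>v. if last w \<noteq> dst I \<and> {last w, v} \<in> edges I - B then w @ [v] else w)
      (A \<omega> I w (revealed B w))) \<in> measurable M (count_space UNIV)" for w
    by (rule measurable_compose[OF A]) simp
  from measurable_compose_countable[OF this Suc] show ?case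
    by (simp add: Let_def)
qed simp

lemma borel_measurable_unvisited:
  assumes "randomized_algorithm M A"
  shows "(\<lambda>\<omega>. unvisited k (A \<omega>) i n) \<in> borel_measurable M"
proof -
  have "(\<lambda>\<omega>. (\<lambda>w. of_bool (Suc (Suc i) \<notin> set w) :: real)
      (walk (A \<omega>) (parallel_paths k) (last_edges k) n)) \<in> borel_measurable M"
    by (rule measurable_compose[OF measurable_walk[OF assms]]) simp
  then show ?thesis by (simp add: unvisited_def)
qed

theorem theorem14:
  fixes k :: nat and c :: real
    and M :: "'w measure" and A :: "'w \<Rightarrow> strategy"
  assumes "k \<ge> 1"
    and "c < real k"
    and "randomized_algorithm M A"
  shows "\<exists>I B. ctp_instance k I B \<and> prediction_error I B \<le> 1 \<and> path_disjoint I \<and>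
           expected_cost M A I B > ereal (c * opt_cost I B)"
proof -
  interpret prob_space M using assms(3) by (simp add: randomized_algorithm_def)
  \<comment> \<open>For each outcome \<open>F i\<close> bounds the cost on the \<open>i\<close>-th
    instance from below. Being bounded, it allows the averaging to be done with real integrals
    although the cost itself may be infinite.\<close>
  define F where "F i \<omega> = (\<Sum>n<2 * k. unvisited k (A \<omega>) i n)" for i \<omega>
  have F_nonneg: "0 \<le> F i \<omega>" for i \<omega>
    unfolding F_def by (intro sum_nonneg) (simp add: unvisited_def)
  have unvisited_integrable: "integrable M (\<lambda>\<omega>. unvisited k (A \<omega>) i n)" for i n
    using borel_measurable_unvisited[OF assms(3)]
    by (intro integrable_const_bound[where B = 1]) (auto simp: unvisited_def)
  have F_integrable: "integrable M (F i)" for i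
    unfolding F_def by (intro Bochner_Integration.integrable_sum unvisited_integrable)
  have "real (k * k) = (\<integral>\<omega>. real (k * k) \<partial>M)" by (simp add: prob_space)
  also have "\<dots> \<le> (\<integral>\<omega>. (\<Sum>i<k. F i \<omega>) \<partial>M)"
    by (intro integral_mono Bochner_Integration.integrable_sum F_integrable)
      (use sum_unvisited_ge in \<open>auto simp: F_def\<close>)
  also have "\<dots> = (\<Sum>i<k. \<integral>\<omega>. F i \<omega> \<partial>M)"
    by (intro Bochner_Integration.integral_sum F_integrable)
  finally have sum_ge: "real (k * k) \<le> (\<Sum>i<k. \<integral>\<omega>. F i \<omega> \<partial>M)" .
  \<comment> \<open>Some expectation is at least the average over \<open>i\<close>, which is at
    least \<open>k\<close> and so exceeds \<open>c\<close>.\<close>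
  have "\<exists>i<k. c < (\<integral>\<omega>. F i \<omega> \<partial>M)"
  proof (rule ccontr)
    assume "\<not> ?thesis"
    then have "(\<Sum>i<k. \<integral>\<omega>. F i \<omega> \<partial>M) \<le> (\<Sum>i<k. c)"
      by (intro sum_mono) (meson lessThan_iff not_less)
    also have "\<dots> < real (k * k)" using assms(1,2) by simp
    finally show False using sum_ge by simp
  qed
  then obtain i where i: "i < k" "c < (\<integral>\<omega>. F i \<omega> \<partial>M)" by blast
  let ?I = "parallel_paths k"
  let ?B = "last_edges k - {last_edge i}"
  have "ennreal (\<integral>\<omega>. F i \<omega> \<partial>M) = (\<integral>\<^sup>+\<omega>. ennreal (F i \<omega>) \<partial>M)"
    by (rule nn_integral_eq_integral[symmetric]) (use F_integrable F_nonneg in auto)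
  also have "\<dots> \<le> (\<integral>\<^sup>+\<omega>. alg_cost (A \<omega>) ?I ?B \<partial>M)"
    unfolding F_def by (intro nn_integral_mono alg_cost_ge_unvisited)
  finally have "enn2ereal (ennreal (\<integral>\<omega>. F i \<omega> \<partial>M)) \<le> expected_cost M A ?I ?B"
    by (simp add: expected_cost_def less_eq_ennreal.rep_eq)
  moreover have "enn2ereal (ennreal (\<integral>\<omega>. F i \<omega> \<partial>M)) = ereal (\<integral>\<omega>. F i \<omega> \<partial>M)"
    using F_nonneg by (intro enn2ereal_ennreal integral_nonneg_AE) auto
  ultimately have "ereal (\<integral>\<omega>. F i \<omega> \<partial>M) \<le> expected_cost M A ?I ?B" by simp
  then have "ereal (c * opt_cost ?I ?B) < expected_cost M A ?I ?B"
    using i less_le_trans[of "ereal c" "ereal (\<integral>\<omega>. F i \<omega> \<partial>M)"]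
    by (simp add: opt_cost_parallel_paths)
  with i(1) ctp_instance_parallel_paths prediction_error_parallel_paths
    path_disjoint_parallel_paths show ?thesis
    by (metis order_refl)
qed

end
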